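(* Let $(\Omega,\mathrm{pr})$ be a probability scheme. The associations $$\pi\mapsto\mathcal{A}_{\pi},\qquad\mathcal{A}\mapsto\;\equiv_{\mathcal{A}},\qquad\equiv\;\mapsto\pi_{\equiv}$$ are one-to-one correspondences among the following three types of objects: (1) bundles with total scheme $(\Omega,\mathrm{pr})$, considered up to relabeling of the base scheme; (2) unital $\mathbb{R}$-subalgebras of $\mathbb{R}^{\Omega}$; (3) equivalence relations on $\Omega$ (equivalently, partitions of $\Omega$). Here the first association goes from (1) to (2), the second from (2) to (3), and the third from (3) to (1); the inverse of any one of the three is the composite of the other two.
   Context: A (probability) scheme is a finite set $\Omega$ with a function $\mathrm{pr}\colon\Omega\to(0,\infty)$ such that $\sum_{\omega}\mathrm{pr}(\omega)=1$. $\mathbb{R}^{\Omega}$ is the real algebra of functions $\Omega\to\mathbb{R}$ under pointwise operations. A bundle $\pi\colon(\Omega,\mathrm{pr})\to(\Omega',\mathrm{pr}')$, with total scheme $\Omega$ and base scheme $\Omega'$, is a map $\pi\colon\Omega\to\Omega'$ with $\mathrm{pr}'(\omega')=\sum_{\omega\in\pi^{-1}(\omega')}\mathrm{pr}(\omega)$ for all $\omega'\in\Omega'$ (hence surjective). Two bundles $\pi_1\colon\Omega\to\Omega_1'$, $\pi_2\colon\Omega\to\Omega_2'$ agree up to relabeling of the base if there is a probability-preserving bijection $\varphi\colon\Omega_1'\to\Omega_2'$ with $\varphi\pi_1=\pi_2$. The associated algebra of $\pi$ is $\mathcal{A}_{\pi}=\{Z\circ\pi: Z\in\mathbb{R}^{\Omega'}\}$,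 i.e. the algebra of functions constant on the fibers of $\pi$. For a unital subalgebra $\mathcal{A}$, $\omega_1\equiv_{\mathcal{A}}\omega_2\iff X(\omega_1)=X(\omega_2)$ for all $X\in\mathcal{A}$. For an equivalence relation $\equiv$ on $\Omega$, $\pi_{\equiv}$ is the quotient map $\Omega\to\Omega/{\equiv}$, where $\Omega/{\equiv}$ carries the induced distribution (the probability of a class being the sum of the probabilities of its elements). *)

theory Defs
  imports Complex_Main "HOL-Library.FuncSet" "HOL-Library.Disjoint_Sets"
begin

datatype 'a scheme = Scheme (outcomes: "'a set") (pr: "'a \<Rightarrow> real")

definition prob_scheme :: "'a scheme \<Rightarrow> bool" where
  "prob_scheme S \<longleftrightarrow>
     finite (outcomes S) \<and> (\<forall>\<omega>\<in>outcomes S. pr S \<omega> > 0) \<and> (\<Sum>\<omega>\<in>outcomes S. pr S \<omega>) = 1"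

text \<open>A bundle is recorded as its base scheme together with its projection; the total scheme is
  always an explicit parameter. Values of the projection, or of the base probability function,
  outside their domains are immaterial: no notion below looks at them, apart from equality of
  records, which is only ever used up to relabeling.\<close>

datatype ('a, 'b) scheme_bundle =
  SchemeBundle (base: "'b scheme") (projection: "'a \<Rightarrow> 'b")

definition bundles :: "'a scheme \<Rightarrow> ('a, 'b) scheme_bundle set" where
  "bundles S = {B. prob_scheme (base B) \<and>
     projection B \<in> outcomes S \<rightarrow> outcomes (base B) \<and>
     (\<forall>\<omega>'\<in>outcomes (base B).
        pr (base B) \<omega>' = (\<Sum>\<omega> | \<omega> \<in> outcomes S \<and> projection B \<omega> = \<omega>'. pr S \<omega>))}"

text \<open>The two bases may live in different types.\<close>

definition agree_up_to_relabeling ::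
    "'a scheme \<Rightarrow> ('a, 'b) scheme_bundle \<Rightarrow> ('a, 'c) scheme_bundle \<Rightarrow> bool" where
  "agree_up_to_relabeling S B1 B2 \<longleftrightarrow>
     (\<exists>\<phi>. bij_betw \<phi> (outcomes (base B1)) (outcomes (base B2)) \<and>
          (\<forall>\<omega>'\<in>outcomes (base B1). pr (base B2) (\<phi> \<omega>') = pr (base B1) \<omega>') \<and>
          (\<forall>\<omega>\<in>outcomes S. \<phi> (projection B1 \<omega>) = projection B2 \<omega>))"

definition relabeling :: "'a scheme \<Rightarrow> ('a, 'b) scheme_bundle rel" where
  "relabeling S = {(B1, B2). B1 \<in> bundles S \<and> B2 \<in> bundles S \<and> agree_up_to_relabeling S B1 B2}"

definition bundle_classes :: "'a scheme \<Rightarrow> ('a, 'b) scheme_bundle set set" where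
  "bundle_classes S = bundles S // relabeling S"

text \<open>The algebra of real functions on a scheme consists of functions that are
  \<^const>\<open>undefined\<close> off the carrier, so that equality of elements is equality on the carrier.\<close>

definition unital_subalgebras :: "'a scheme \<Rightarrow> ('a \<Rightarrow> real) set set" where
  "unital_subalgebras S = {A. A \<subseteq> (outcomes S \<rightarrow>\<^sub>E UNIV) \<and>
     (\<lambda>\<omega>\<in>outcomes S. 1) \<in> A \<and>
     (\<forall>X\<in>A. \<forall>Y\<in>A. (\<lambda>\<omega>\<in>outcomes S. X \<omega> + Y \<omega>) \<in> A) \<and>
     (\<forall>X\<in>A. \<forall>Y\<in>A. (\<lambda>\<omega>\<in>outcomes S. X \<omega> * Y \<omega>) \<in> A) \<and>
     (\<forall>c. \<forall>X\<in>A. (\<lambda>\<omega>\<in>outcomes S. c * X \<omega>) \<in> A)}"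

definition equivalence_relations :: "'a scheme \<Rightarrow> 'a rel set" where
  "equivalence_relations S = {r. equiv (outcomes S) r}"

definition assoc_algebra :: "'a scheme \<Rightarrow> ('a, 'b) scheme_bundle \<Rightarrow> ('a \<Rightarrow> real) set" where
  "assoc_algebra S B =
     {compose (outcomes S) Z (projection B) | Z. Z \<in> outcomes (base B) \<rightarrow>\<^sub>E UNIV}"

definition algebra_equiv :: "'a scheme \<Rightarrow> ('a \<Rightarrow> real) set \<Rightarrow> 'a rel" where
  "algebra_equiv S A =
     {(\<omega>1, \<omega>2). \<omega>1 \<in> outcomes S \<and> \<omega>2 \<in> outcomes S \<and> (\<forall>X\<in>A. X \<omega>1 = X \<omega>2)}"

definition quotient_bundle :: "'a scheme \<Rightarrow> 'a rel \<Rightarrow> ('a, 'a set) scheme_bundle" where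
  "quotient_bundle S r =
     SchemeBundle (Scheme (outcomes S // r) (\<lambda>C. \<Sum>\<omega>\<in>C. pr S \<omega>)) (\<lambda>\<omega>. r `` {\<omega>})"

text \<open>The first and the third association, with bundles replaced by their relabeling classes.
  The first is meaningful because \<^const>\<open>assoc_algebra\<close> respects relabeling.\<close>

definition class_algebra :: "'a scheme \<Rightarrow> ('a, 'b) scheme_bundle set \<Rightarrow> ('a \<Rightarrow> real) set" where
  "class_algebra S K = the_elem (assoc_algebra S ` K)"

definition quotient_class :: "'a scheme \<Rightarrow> 'a rel \<Rightarrow> ('a, 'a set) scheme_bundle set" where
  "quotient_class S r = relabeling S `` {quotient_bundle S r}"

end

theory Submission
  imports Defs
begin

text \<open>Bundles, subalgebras and equivalence relations are all compared through one equivalence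
  relation on the outcomes: a bundle is determined up to relabeling by the kernel of its projection,
  and its algebra consists of the functions invariant under that kernel. The remaining point is that
  a unital subalgebra contains every function that is constant on its classes: Lagrange
  interpolation between the classes puts the indicator of each class into the algebra.\<close>

section \<open>Equivalence relations and their invariant functions\<close>

definition invariant_functions :: "'a set \<Rightarrow> 'a rel \<Rightarrow> ('a \<Rightarrow> real) set" where
  "invariant_functions \<Omega> r = {X \<in> \<Omega> \<rightarrow>\<^sub>E UNIV. X respects r}"

text \<open>Up to relabeling this relation is all the data of a bundle: the base probabilities are
  forced as fiber sums. Restricting it to the outcomes hides the immaterial values of the projection
  elsewhere.\<close>

definition bundle_kernel :: "'a scheme \<Rightarrow> ('a, 'b) scheme_bundle \<Rightarrow> 'a rel" where
  "bundle_kernel S B =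
     {(x, y). x \<in> outcomes S \<and> y \<in> outcomes S \<and> projection B x = projection B y}"

lemma equiv_bundle_kernel: "equiv (outcomes S) (bundle_kernel S B)"
  by (rule equivI) (auto simp: bundle_kernel_def refl_on_def sym_def trans_def)

lemma equiv_algebra_equiv: "equiv (outcomes S) (algebra_equiv S A)"
  by (rule equivI) (auto simp: algebra_equiv_def refl_on_def sym_def trans_def)

lemma invariant_functions_in_unital_subalgebras:
  assumes "equiv (outcomes S) r"
  shows "invariant_functions (outcomes S) r \<in> unital_subalgebras S"
proof -
  \<comment> \<open>Related points lie in the carrier, where the restricted operations are the
    pointwise ones, so invariance survives them.\<close>
  have "x \<in> outcomes S \<and> y \<in> outcomes S" if "(x, y) \<in> r" for x y
    using equiv_type[OF assms] that by blast
  then show ?thesis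
    unfolding unital_subalgebras_def invariant_functions_def congruent_def by fastforce
qed

text \<open>The indicator of the class of x is itself invariant and separates x from every point
  outside that class.\<close>

lemma algebra_equiv_invariant_functions:
  assumes "equiv (outcomes S) r"
  shows "algebra_equiv S (invariant_functions (outcomes S) r) = r"
proof (intro subset_antisym subrelI)
  fix x y assume xy: "(x, y) \<in> algebra_equiv S (invariant_functions (outcomes S) r)"
  let ?X = "\<lambda>\<omega>\<in>outcomes S. if (x, \<omega>) \<in> r then 1 else 0 :: real"
  have "?X respects r"
  proof (rule congruentI)
    fix u v assume "(u, v) \<in> r"
    then have "u \<in> outcomes S" "v \<in> outcomes S" "(x, u) \<in> r \<longleftrightarrow> (x, v) \<in> r"
      using assms unfolding equiv_def sym_def trans_def by blast+
    then show "?X u = ?X v" by simp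
  qed
  then have "?X \<in> invariant_functions (outcomes S) r"
    by (simp add: invariant_functions_def)
  then have "?X x = ?X y" and "x \<in> outcomes S" "y \<in> outcomes S"
    using xy by (simp_all add: algebra_equiv_def del: restrict_apply)
  moreover have "(x, x) \<in> r"
    using assms \<open>x \<in> outcomes S\<close> by (auto simp: equiv_def refl_on_def)
  ultimately show "(x, y) \<in> r" by (simp split: if_splits)
next
  fix x y assume "(x, y) \<in> r"
  then show "(x, y) \<in> algebra_equiv S (invariant_functions (outcomes S) r)"
    using equiv_type[OF assms]
    by (auto simp: algebra_equiv_def invariant_functions_def dest: congruentD)
qed

section \<open>Unital subalgebras of the functions on a finite set\<close>

locale unital_subalgebra =
  fixes S :: "'a scheme" and A :: "('a \<Rightarrow> real) set"
  assumes A: "A \<in> unital_subalgebras S"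
begin

abbreviation "\<Omega> \<equiv> outcomes S"

lemma extensional: "X \<in> A \<Longrightarrow> X \<in> \<Omega> \<rightarrow>\<^sub>E UNIV"
  using A by (auto simp: unital_subalgebras_def)

lemma one: "(\<lambda>\<omega>\<in>\<Omega>. 1) \<in> A"
  using A by (simp add: unital_subalgebras_def)

lemma add: "X \<in> A \<Longrightarrow> Y \<in> A \<Longrightarrow> (\<lambda>\<omega>\<in>\<Omega>. X \<omega> + Y \<omega>) \<in> A"
  using A by (simp add: unital_subalgebras_def)

lemma mult: "X \<in> A \<Longrightarrow> Y \<in> A \<Longrightarrow> (\<lambda>\<omega>\<in>\<Omega>. X \<omega> * Y \<omega>) \<in> A"
  using A by (simp add: unital_subalgebras_def)

lemma scale: "X \<in> A \<Longrightarrow> (\<lambda>\<omega>\<in>\<Omega>. c * X \<omega>) \<in> A"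
  using A by (simp add: unital_subalgebras_def)

text \<open>Constants serve as the empty sum and the empty product, and as the shift in
  \<open>separating_function\<close>.\<close>

lemma const: "(\<lambda>\<omega>\<in>\<Omega>. c) \<in> A"
  using scale[OF one, of c] by (simp cong: restrict_cong)

lemma sum_closed:
  assumes "finite I" "\<And>i. i \<in> I \<Longrightarrow> f i \<in> A"
  shows "(\<lambda>\<omega>\<in>\<Omega>. \<Sum>i\<in>I. f i \<omega>) \<in> A"
  using assms
proof (induction I rule: finite_induct)
  case empty
  show ?case using const[of 0] by (simp only: sum.empty)
next
  case (insert i I)
  let ?g = "\<lambda>\<omega>\<in>\<Omega>. \<Sum>i\<in>I. f i \<omega>"
  have "(\<lambda>\<omega>\<in>\<Omega>. \<Sum>i\<in>insert i I. f i \<omega>) = (\<lambda>\<omega>\<in>\<Omega>. f i \<omega> + ?g \<omega>)"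
    using insert.hyps by (intro restrict_ext) simp
  also have "\<dots> \<in> A"
    using insert.IH insert.prems by (intro add) auto
  finally show ?case .
qed

lemma prod_closed:
  assumes "finite I" "\<And>i. i \<in> I \<Longrightarrow> f i \<in> A"
  shows "(\<lambda>\<omega>\<in>\<Omega>. \<Prod>i\<in>I. f i \<omega>) \<in> A"
  using assms
proof (induction I rule: finite_induct)
  case empty
  show ?case using const[of 1] by (simp only: prod.empty)
next
  case (insert i I)
  let ?g = "\<lambda>\<omega>\<in>\<Omega>. \<Prod>i\<in>I. f i \<omega>"
  have "(\<lambda>\<omega>\<in>\<Omega>. \<Prod>i\<in>insert i I. f i \<omega>) = (\<lambda>\<omega>\<in>\<Omega>. f i \<omega> * ?g \<omega>)"
    using insert.hyps by (intro restrict_ext) simp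
  also have "\<dots> \<in> A"
    using insert.IH insert.prems by (intro mult) auto
  finally show ?case .
qed

lemma separating_function:
  assumes "x \<in> \<Omega>" "y \<in> \<Omega>" "(x, y) \<notin> algebra_equiv S A"
  obtains X where "X \<in> A" "X x = 1" "X y = 0"
proof -
  obtain Y where Y: "Y \<in> A" "Y x \<noteq> Y y"
    using assms by (auto simp: algebra_equiv_def)
  \<comment> \<open>This is (Y - Y y) / (Y x - Y y), with restrictions nested so that the closure
    rules match it literally.\<close>
  let ?X = "\<lambda>\<omega>\<in>\<Omega>. (1 / (Y x - Y y)) * (\<lambda>\<omega>\<in>\<Omega>. Y \<omega> + (\<lambda>\<omega>\<in>\<Omega>. - Y y) \<omega>) \<omega>"
  show thesis
  proof
    show "?X \<in> A" by (intro scale add const Y)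
    show "?X x = 1" "?X y = 0" using assms Y by simp_all
  qed
qed

text \<open>The indicator is a finite product of separating functions, one for each point not
  equivalent to x. Indexing by points instead of classes only repeats zeros and avoids choosing
  representatives.\<close>

lemma class_indicator_in:
  assumes "finite \<Omega>" "x \<in> \<Omega>"
  shows "(\<lambda>\<omega>\<in>\<Omega>. if (x, \<omega>) \<in> algebra_equiv S A then 1 else 0) \<in> A"
proof -
  let ?N = "{y \<in> \<Omega>. (x, y) \<notin> algebra_equiv S A}"
  have "\<exists>X. X \<in> A \<and> X x = 1 \<and> X y = 0" if "y \<in> ?N" for y
    using separating_function[OF assms(2), of y] that by (metis (mono_tags) mem_Collect_eq)
  then obtain e where "\<forall>y\<in>?N. e y \<in> A \<and> e y x = 1 \<and> e y y = 0"
    using bchoice[of ?N "\<lambda>y X. X \<in> A \<and> X x = 1 \<and> X y = 0"] by auto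
  then have e: "e y \<in> A" "e y x = 1" "e y y = 0" if "y \<in> ?N" for y
    using that by auto
  have "(\<Prod>y\<in>?N. e y \<omega>) = (if (x, \<omega>) \<in> algebra_equiv S A then 1 else 0)" if "\<omega> \<in> \<Omega>" for \<omega>
  proof (cases "(x, \<omega>) \<in> algebra_equiv S A")
    case True
    \<comment> \<open>Every factor lies in A, hence is constant on the class of x and keeps there
      its value 1 at x.\<close>
    then have "X x = X \<omega>" if "X \<in> A" for X
      using that by (auto simp: algebra_equiv_def)
    from this[OF e(1)] have "e y \<omega> = 1" if "y \<in> ?N" for y
      using e(2)[OF that] that by simp
    then show ?thesis using True by simp
  next
    case False
    with that have "\<omega> \<in> ?N" by simp
    \<comment> \<open>The factor indexed by \<omega> itself vanishes at \<omega>.\<close>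
    then have "(\<Prod>y\<in>?N. e y \<omega>) = 0"
      using e(3)[of \<omega>] assms(1) by (intro prod_zero bexI[of _ \<omega>]) simp_all
    then show ?thesis using False by simp
  qed
  then have "(\<lambda>\<omega>\<in>\<Omega>. \<Prod>y\<in>?N. e y \<omega>)
      = (\<lambda>\<omega>\<in>\<Omega>. if (x, \<omega>) \<in> algebra_equiv S A then 1 else 0)"
    by (rule restrict_ext)
  moreover have "(\<lambda>\<omega>\<in>\<Omega>. \<Prod>y\<in>?N. e y \<omega>) \<in> A"
    using assms(1) e(1) by (intro prod_closed) simp_all
  ultimately show ?thesis by (simp only:)
qed

text \<open>On a finite carrier an invariant function is a linear combination of class indicators,
  and these lie in A. The other inclusion is immediate, since members of A cannot distinguish
  equivalent points.\<close>

lemma invariant_functions_algebra_equiv: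
  assumes "finite \<Omega>"
  shows "invariant_functions \<Omega> (algebra_equiv S A) = A"
proof
  show "A \<subseteq> invariant_functions \<Omega> (algebra_equiv S A)"
    using extensional by (auto simp: invariant_functions_def congruent_def algebra_equiv_def)
next
  let ?r = "algebra_equiv S A"
  show "invariant_functions \<Omega> ?r \<subseteq> A"
  proof
    fix X assume "X \<in> invariant_functions \<Omega> ?r"
    then have X: "X \<in> \<Omega> \<rightarrow>\<^sub>E UNIV" "\<And>x y. (x, y) \<in> ?r \<Longrightarrow> X x = X y"
      by (auto simp: invariant_functions_def dest: congruentD)
    \<comment> \<open>Dividing by the class size allows summing over all outcomes instead of representatives.\<close>
    let ?f = "\<lambda>x. \<lambda>\<omega>\<in>\<Omega>. (X x / real (card (?r `` {x}))) *
                (\<lambda>\<omega>\<in>\<Omega>. if (x, \<omega>) \<in> ?r then 1 else 0) \<omega>"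
    have "(\<Sum>x\<in>\<Omega>. ?f x \<omega>) = X \<omega>" if \<omega>: "\<omega> \<in> \<Omega>" for \<omega>
    proof -
      \<comment> \<open>Symmetry rewrites the class through first components, the position of the
        summation variable.\<close>
      have cls: "?r `` {\<omega>} = {x \<in> \<Omega>. (x, \<omega>) \<in> ?r}"
        by (auto simp: algebra_equiv_def)
      have "\<omega> \<in> ?r `` {\<omega>}" "finite (?r `` {\<omega>})"
        using \<omega> assms unfolding cls by (auto simp: algebra_equiv_def)
      then have nonempty: "card (?r `` {\<omega>}) \<noteq> 0"
        by auto
      have "(\<Sum>x\<in>\<Omega>. ?f x \<omega>)
          = (\<Sum>x\<in>\<Omega>. if (x, \<omega>) \<in> ?r then X \<omega> / real (card (?r `` {\<omega>})) else 0)"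
      proof (intro sum.cong refl)
        fix x assume "x \<in> \<Omega>"
        show "?f x \<omega> = (if (x, \<omega>) \<in> ?r then X \<omega> / real (card (?r `` {\<omega>})) else 0)"
          \<comment> \<open>An x equivalent to \<omega> has both the same value of X and the same
            class, so its coefficient is that of \<omega>.\<close>
          using \<omega> X(2)[of x \<omega>] equiv_class_eq[OF equiv_algebra_equiv, of x \<omega> S A] by auto
      qed
      also have "\<dots> = (\<Sum>x\<in>?r `` {\<omega>}. X \<omega> / real (card (?r `` {\<omega>})))"
        unfolding cls using assms by (simp add: sum.If_cases Int_def conj_commute)
      also have "\<dots> = X \<omega>" using nonempty by simp
      finally show ?thesis .
    qed
    then have "X = (\<lambda>\<omega>\<in>\<Omega>. \<Sum>x\<in>\<Omega>. ?f x \<omega>)"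
      using X(1) by (auto simp: fun_eq_iff PiE_def extensional_def)
    also have "\<dots> \<in> A"
      by (intro sum_closed scale class_indicator_in assms)
    finally show "X \<in> A" .
  qed
qed

end

section \<open>Bundles, their kernels and their algebras\<close>

lemma sum_fiber_pos:
  assumes "prob_scheme S" "\<omega> \<in> outcomes S" "P \<omega>"
  shows "(\<Sum>x | x \<in> outcomes S \<and> P x. pr S x) > 0"
  using assms by (intro sum_pos) (auto simp: prob_scheme_def)

text \<open>This surjectivity allows base points to be lifted to outcomes and the base to be
  rewritten as an image.\<close>

lemma bundle_projection_image:
  assumes "B \<in> bundles S"
  shows "projection B ` outcomes S = outcomes (base B)"
proof
  show "projection B ` outcomes S \<subseteq> outcomes (base B)"
    using assms by (simp add: bundles_def image_subset_iff_funcset)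
  show "outcomes (base B) \<subseteq> projection B ` outcomes S"
  proof
    fix b assume b: "b \<in> outcomes (base B)"
    \<comment> \<open>An empty fiber would have probability zero.\<close>
    then have "(\<Sum>\<omega> | \<omega> \<in> outcomes S \<and> projection B \<omega> = b. pr S \<omega>) > 0"
      using assms by (auto simp: bundles_def prob_scheme_def)
    then have "{\<omega>. \<omega> \<in> outcomes S \<and> projection B \<omega> = b} \<noteq> {}"
      by (intro notI) (simp only: sum.empty less_irrefl)
    then show "b \<in> projection B ` outcomes S" by auto
  qed
qed

text \<open>A function factors through the projection exactly when it is constant on the
  fibers.\<close>

lemma assoc_algebra_eq_invariant_functions:
  assumes "B \<in> bundles S"
  shows "assoc_algebra S B = invariant_functions (outcomes S) (bundle_kernel S B)"
proof (intro subset_antisym subsetI)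
  fix X assume "X \<in> assoc_algebra S B"
  then obtain Z where "X = compose (outcomes S) Z (projection B)"
    by (auto simp: assoc_algebra_def)
  then show "X \<in> invariant_functions (outcomes S) (bundle_kernel S B)"
    by (auto simp: invariant_functions_def bundle_kernel_def congruent_def compose_eq PiE_iff)
next
  fix X assume X: "X \<in> invariant_functions (outcomes S) (bundle_kernel S B)"
  \<comment> \<open>Z evaluates X at a chosen point of each fiber; invariance of X makes the choice
    immaterial.\<close>
  let ?Z = "\<lambda>b\<in>outcomes (base B). X (inv_into (outcomes S) (projection B) b)"
  have "?Z (projection B \<omega>) = X \<omega>" if \<omega>: "\<omega> \<in> outcomes S" for \<omega>
  proof -
    let ?\<omega>' = "inv_into (outcomes S) (projection B) (projection B \<omega>)"
    have "(?\<omega>', \<omega>) \<in> bundle_kernel S B"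
      using inv_into_into[OF imageI[OF \<omega>, of "projection B"]]
        f_inv_into_f[OF imageI[OF \<omega>, of "projection B"]] \<omega>
      by (simp add: bundle_kernel_def)
    moreover have "X respects bundle_kernel S B"
      using X by (simp add: invariant_functions_def)
    ultimately have "X ?\<omega>' = X \<omega>" by (intro congruentD)
    moreover have "projection B \<omega> \<in> outcomes (base B)"
      using \<omega> bundle_projection_image[OF assms] by blast
    ultimately show ?thesis by simp
  qed
  then have "compose (outcomes S) ?Z (projection B) = X"
    using X by (intro extensionalityI[OF compose_extensional])
      (simp_all add: compose_eq invariant_functions_def PiE_iff)
  then show "X \<in> assoc_algebra S B"
    unfolding assoc_algebra_def by (intro CollectI exI[of _ ?Z] conjI) simp_all
qed

text \<open>Equal kernels mean equal fibers, so matching the fibers gives a bijection of the bases;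
  it preserves probability because base probabilities are fiber sums.\<close>

lemma agree_iff_bundle_kernel_eq:
  assumes "B1 \<in> bundles S" "B2 \<in> bundles S"
  shows "agree_up_to_relabeling S B1 B2 \<longleftrightarrow> bundle_kernel S B1 = bundle_kernel S B2"
proof
  assume "agree_up_to_relabeling S B1 B2"
  then obtain \<phi> where \<phi>: "inj_on \<phi> (outcomes (base B1))"
    "\<And>\<omega>. \<omega> \<in> outcomes S \<Longrightarrow> \<phi> (projection B1 \<omega>) = projection B2 \<omega>"
    by (auto simp: agree_up_to_relabeling_def bij_betw_def)
  have "projection B1 x = projection B1 y \<longleftrightarrow> projection B2 x = projection B2 y"
    if "x \<in> outcomes S" "y \<in> outcomes S" for x y
    using that \<phi> bundle_projection_image[OF assms(1)]
    by (metis imageI inj_on_eq_iff)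
  then show "bundle_kernel S B1 = bundle_kernel S B2"
    by (auto simp: bundle_kernel_def)
next
  assume "bundle_kernel S B1 = bundle_kernel S B2"
  then have ker: "projection B1 x = projection B1 y \<longleftrightarrow> projection B2 x = projection B2 y"
    if "x \<in> outcomes S" "y \<in> outcomes S" for x y
    using that by (auto simp: bundle_kernel_def set_eq_iff)
  \<comment> \<open>Lift a base point to any outcome above it and project by the second bundle;
    equality of kernels makes the result independent of the lift.\<close>
  define \<phi> where "\<phi> b = projection B2 (inv_into (outcomes S) (projection B1) b)" for b
  have \<phi>: "\<phi> (projection B1 \<omega>) = projection B2 \<omega>" if "\<omega> \<in> outcomes S" for \<omega>
    unfolding \<phi>_def using that
    \<comment> \<open>The kernel equality moves the goal to the first projection, where the chosen
      lift is a right inverse.\<close>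
    by (subst ker[symmetric]) (simp_all add: inv_into_into f_inv_into_f)
  note im1 = bundle_projection_image[OF assms(1), symmetric]
    and im2 = bundle_projection_image[OF assms(2), symmetric]
  have "bij_betw \<phi> (outcomes (base B1)) (outcomes (base B2))"
    unfolding im1 im2 bij_betw_def
    by (auto simp: inj_on_def \<phi> ker image_image)
  moreover have "pr (base B2) (\<phi> b) = pr (base B1) b" if b: "b \<in> outcomes (base B1)" for b
  proof -
    obtain x where x: "x \<in> outcomes S" "b = projection B1 x"
      using b unfolding im1 by auto
    have "\<phi> b \<in> outcomes (base B2)"
      using x \<phi> unfolding im2 by auto
    then have "pr (base B2) (\<phi> b)
        = (\<Sum>\<omega> | \<omega> \<in> outcomes S \<and> projection B2 \<omega> = \<phi> b. pr S \<omega>)"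
      using assms(2) by (simp add: bundles_def)
    also have "{\<omega>. \<omega> \<in> outcomes S \<and> projection B2 \<omega> = \<phi> b}
        = {\<omega>. \<omega> \<in> outcomes S \<and> projection B1 \<omega> = b}"
      using x \<phi> ker by auto
    also have "(\<Sum>\<omega>\<in>\<dots>. pr S \<omega>) = pr (base B1) b"
      using assms(1) b by (simp add: bundles_def)
    finally show ?thesis .
  qed
  ultimately show "agree_up_to_relabeling S B1 B2"
    unfolding agree_up_to_relabeling_def using \<phi> by blast
qed

section \<open>Quotient bundles and relabeling classes\<close>

lemma quotient_bundle_in_bundles:
  assumes "prob_scheme S" "equiv (outcomes S) r"
  shows "quotient_bundle S r \<in> bundles S"
proof -
  let ?\<Omega> = "outcomes S"
  have fin: "finite ?\<Omega>" and total: "(\<Sum>\<omega>\<in>?\<Omega>. pr S \<omega>) = 1"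
    using assms(1) by (auto simp: prob_scheme_def)
  \<comment> \<open>The fiber over a class is that class itself, so class sums are the required
    fiber sums. They are positive, and they add up to 1 because the classes partition the
    outcomes.\<close>
  have fiber: "{\<omega>. \<omega> \<in> ?\<Omega> \<and> r `` {\<omega>} = C} = C" if C: "C \<in> ?\<Omega> // r" for C
  proof -
    obtain x where x: "x \<in> ?\<Omega>" "C = r `` {x}" using C by (rule quotientE)
    have "\<omega> \<in> ?\<Omega> \<and> r `` {\<omega>} = r `` {x} \<longleftrightarrow> (x, \<omega>) \<in> r" for \<omega>
      using equiv_class_eq_iff[OF assms(2), of x \<omega>] x by auto
    then show ?thesis using x by auto
  qed
  have "(\<Sum>C\<in>?\<Omega> // r. sum (pr S) C) = sum (pr S) ?\<Omega>"
    using sum.partition[OF fin partition_on_quotient[OF assms(2)], of "pr S"] by simp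
  moreover have "sum (pr S) C > 0" if C: "C \<in> ?\<Omega> // r" for C
  proof -
    obtain x where x: "x \<in> ?\<Omega>" "r `` {x} = C" using C by (auto elim: quotientE)
    show ?thesis
      using sum_fiber_pos[OF assms(1) x(1), of "\<lambda>\<omega>. r `` {\<omega>} = C"] x(2)
      unfolding fiber[OF C] by simp
  qed
  moreover have "finite (?\<Omega> // r)"
    using finite_quotient[OF fin equiv_type[OF assms(2)]] .
  ultimately show ?thesis
    using total fiber
    by (auto simp: bundles_def quotient_bundle_def prob_scheme_def intro: quotientI)
qed

lemma bundle_kernel_quotient_bundle:
  assumes "equiv (outcomes S) r"
  shows "bundle_kernel S (quotient_bundle S r) = r"
proof -
  have "x \<in> outcomes S \<and> y \<in> outcomes S \<and> r `` {x} = r `` {y} \<longleftrightarrow> (x, y) \<in> r" for x y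
    using equiv_class_eq_iff[OF assms, of x y] by blast
  then show ?thesis
    by (simp add: bundle_kernel_def quotient_bundle_def)
qed

text \<open>With relabeling expressed as equality of kernels, its equivalence properties need no
  composition or inversion of bijections.\<close>

lemma relabeling_eq:
  "relabeling S = {(B1, B2). B1 \<in> bundles S \<and> B2 \<in> bundles S \<and>
     bundle_kernel S B1 = bundle_kernel S B2}"
  by (auto simp: relabeling_def agree_iff_bundle_kernel_eq)

lemma equiv_relabeling: "equiv (bundles S) (relabeling S)"
  by (rule equivI) (auto simp: relabeling_eq refl_on_def sym_def trans_def)

lemma assoc_algebra_respects_relabeling: "assoc_algebra S respects relabeling S"
  by (rule congruentI) (auto simp: relabeling_eq assoc_algebra_eq_invariant_functions)

text \<open>All bundles in a class share one kernel, hence one algebra, so \<open>the_elem\<close>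
  is applied to a singleton.\<close>

lemma class_algebra_relabeling_class:
  assumes "B \<in> bundles S"
  shows "class_algebra S (relabeling S `` {B})
    = invariant_functions (outcomes S) (bundle_kernel S B)"
proof -
  have "assoc_algebra S ` (relabeling S `` {B})
      = {invariant_functions (outcomes S) (bundle_kernel S B)}"
    using assms by (auto simp: relabeling_eq assoc_algebra_eq_invariant_functions)
  then show ?thesis by (simp add: class_algebra_def)
qed

section \<open>Inverse bijections, partitions and the threefold correspondence\<close>

text \<open>A two-sided inverse yields bijectivity and also pins down the choice made by
  \<open>inv_into\<close>.\<close>

lemma bij_betw_inv_into_eqI:
  assumes "f \<in> X \<rightarrow> Y" "g \<in> Y \<rightarrow> X"
    and "\<And>x. x \<in> X \<Longrightarrow> g (f x) = x" "\<And>y. y \<in> Y \<Longrightarrow> f (g y) = y"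
  shows "bij_betw f X Y" "\<forall>y\<in>Y. inv_into X f y = g y"
proof -
  show bij: "bij_betw f X Y" by (rule bij_betwI[OF assms])
  show "\<forall>y\<in>Y. inv_into X f y = g y"
    using assms bij by (auto intro!: inv_into_f_eq simp: bij_betw_def)
qed

lemma bij_betw_quotient_partition_on:
  "bij_betw (\<lambda>r. \<Omega> // r) {r. equiv \<Omega> r} {P. partition_on \<Omega> P}"
proof -
  have "r = s" if "equiv \<Omega> r" "equiv \<Omega> s" "\<Omega> // r = \<Omega> // s" for r s
  proof -
    \<comment> \<open>The classes determine the relation: two points are related exactly when they
      share a class. This gives injectivity.\<close>
    have mem: "(x, y) \<in> t \<longleftrightarrow> (\<exists>C\<in>\<Omega> // t. x \<in> C \<and> y \<in> C)" if t: "equiv \<Omega> t" for t x y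
    proof
      assume xy: "(x, y) \<in> t"
      then have x: "x \<in> \<Omega>" using equiv_type[OF t] by auto
      show "\<exists>C\<in>\<Omega> // t. x \<in> C \<and> y \<in> C"
        using xy equiv_class_self[OF t x] quotientI[OF x, of t] by blast
    next
      assume "\<exists>C\<in>\<Omega> // t. x \<in> C \<and> y \<in> C"
      then show "(x, y) \<in> t" using in_quotient_imp_in_rel[OF t] by blast
    qed
    show ?thesis
      by (rule set_eqI) (simp only: split_paired_all mem[OF that(1)] mem[OF that(2)] that(3))
  qed
  then have "inj_on (\<lambda>r. \<Omega> // r) {r. equiv \<Omega> r}"
    by (simp add: inj_on_def)
  moreover have "(\<lambda>r. \<Omega> // r) ` {r. equiv \<Omega> r} = {P. partition_on \<Omega> P}"
    unfolding partition_on_alt by blast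
  ultimately show ?thesis by (simp add: bij_betw_def)
qed

theorem mainTheorem11:
  fixes S :: "'a scheme"
  assumes "prob_scheme S"
  shows
    "equiv (bundles S) (relabeling S :: ('a, 'a set) scheme_bundle rel) \<and>
     assoc_algebra S respects (relabeling S :: ('a, 'a set) scheme_bundle rel) \<and>
     bij_betw (class_algebra S)
       (bundle_classes S :: ('a, 'a set) scheme_bundle set set) (unital_subalgebras S) \<and>
     bij_betw (algebra_equiv S) (unital_subalgebras S) (equivalence_relations S) \<and>
     bij_betw (quotient_class S) (equivalence_relations S) (bundle_classes S) \<and>
     bij_betw (\<lambda>r. outcomes S // r) (equivalence_relations S) {P. partition_on (outcomes S) P} \<and>
     (\<forall>A\<in>unital_subalgebras S.
        inv_into (bundle_classes S) (class_algebra S) A = (quotient_class S \<circ> algebra_equiv S) A) \<and>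
     (\<forall>r\<in>equivalence_relations S.
        inv_into (unital_subalgebras S) (algebra_equiv S) r = (class_algebra S \<circ> quotient_class S) r) \<and>
     (\<forall>K\<in>bundle_classes S.
        inv_into (equivalence_relations S) (quotient_class S) K = (algebra_equiv S \<circ> class_algebra S) K) \<and>
     (\<forall>B \<in> bundles S :: ('a, 'b) scheme_bundle set.
        assoc_algebra S B \<in> unital_subalgebras S \<and>
        agree_up_to_relabeling S B (quotient_bundle S (algebra_equiv S (assoc_algebra S B)))) \<and>
     (\<forall>B1 \<in> bundles S :: ('a, 'b) scheme_bundle set. \<forall>B2 \<in> bundles S :: ('a, 'c) scheme_bundle set.
        agree_up_to_relabeling S B1 B2 \<longleftrightarrow> assoc_algebra S B1 = assoc_algebra S B2)"
proof -
  let ?K = "bundle_classes S :: ('a, 'a set) scheme_bundle set set"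
    and ?U = "unital_subalgebras S" and ?E = "equivalence_relations S"
  let ?c = "class_algebra S :: ('a, 'a set) scheme_bundle set \<Rightarrow> _"
    and ?a = "algebra_equiv S" and ?q = "quotient_class S"
  have fin: "finite (outcomes S)"
    using assms by (simp add: prob_scheme_def)
  have inv_a: "invariant_functions (outcomes S) (?a A) = A" if "A \<in> ?U" for A
    using that fin by (simp add: unital_subalgebra.invariant_functions_algebra_equiv
        unital_subalgebra.intro)
  have cq: "?c (?q r) = invariant_functions (outcomes S) r" if "r \<in> ?E" for r
    using that quotient_bundle_in_bundles[OF assms, of r]
    by (simp add: quotient_class_def class_algebra_relabeling_class
        bundle_kernel_quotient_bundle equivalence_relations_def)
  have aE: "?a A \<in> ?E" for A
    by (simp add: equivalence_relations_def equiv_algebra_equiv)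
  have qK: "?q r \<in> ?K" if "r \<in> ?E" for r
    using that quotient_bundle_in_bundles[OF assms, of r]
    by (auto simp: quotient_class_def bundle_classes_def equivalence_relations_def
        intro: quotientI)
  have cU: "?c K \<in> ?U" if "K \<in> ?K" for K
    using that unfolding bundle_classes_def
    by (auto elim!: quotientE simp: class_algebra_relabeling_class
        invariant_functions_in_unital_subalgebras equiv_bundle_kernel)
  \<comment> \<open>The three cyclic composites are identities. For each association, two of them
    say that the composite of the other two is its inverse on either side.\<close>
  have acq: "?a (?c (?q r)) = r" if "r \<in> ?E" for r
    using that cq[OF that]
    by (simp add: equivalence_relations_def algebra_equiv_invariant_functions)
  have cqa: "?c (?q (?a A)) = A" if "A \<in> ?U" for A
    using cq[OF aE] inv_a[OF that] by simp
  have qac: "?q (?a (?c K)) = K" if "K \<in> ?K" for K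
  proof -
    obtain B where B: "B \<in> bundles S" "K = relabeling S `` {B}"
      using \<open>K \<in> ?K\<close> unfolding bundle_classes_def by (rule quotientE)
    let ?r = "bundle_kernel S B"
    have "?a (?c K) = ?r"
      using B by (simp add: class_algebra_relabeling_class algebra_equiv_invariant_functions
          equiv_bundle_kernel)
    \<comment> \<open>The quotient by the kernel of B has the same kernel as B, hence represents the
      same relabeling class.\<close>
    moreover have "(quotient_bundle S ?r, B) \<in> relabeling S"
      using B quotient_bundle_in_bundles[OF assms equiv_bundle_kernel]
      by (simp add: relabeling_eq bundle_kernel_quotient_bundle equiv_bundle_kernel)
    then have "?q ?r = K"
      unfolding quotient_class_def B(2) by (rule equiv_class_eq[OF equiv_relabeling])
    ultimately show ?thesis by simp
  qed
  have c: "bij_betw ?c ?K ?U" "\<forall>A\<in>?U. inv_into ?K ?c A = (?q \<circ> ?a) A"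
    using bij_betw_inv_into_eqI[of ?c ?K ?U "?q \<circ> ?a"] aE qK cU cqa qac by auto
  have a: "bij_betw ?a ?U ?E" "\<forall>r\<in>?E. inv_into ?U ?a r = (?c \<circ> ?q) r"
    using bij_betw_inv_into_eqI[of ?a ?U ?E "?c \<circ> ?q"] aE qK cU cqa acq by auto
  have q: "bij_betw ?q ?E ?K" "\<forall>K\<in>?K. inv_into ?E ?q K = (?a \<circ> ?c) K"
    using bij_betw_inv_into_eqI[of ?q ?E ?K "?a \<circ> ?c"] aE qK cU acq qac by auto
  have part: "bij_betw (\<lambda>r. outcomes S // r) ?E {P. partition_on (outcomes S) P}"
    unfolding equivalence_relations_def by (rule bij_betw_quotient_partition_on)
  \<comment> \<open>Relabeling classes were formed with base type \<open>'a set\<close>. Here the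
    base type is arbitrary, and each bundle still agrees with a quotient bundle, so fixing that type
    loses no bundle.\<close>
  have b: "assoc_algebra S B \<in> ?U \<and>
      agree_up_to_relabeling S B (quotient_bundle S (?a (assoc_algebra S B)))"
    if "B \<in> bundles S" for B :: "('a, 'b) scheme_bundle"
    using that quotient_bundle_in_bundles[OF assms equiv_bundle_kernel, of B]
    by (simp add: assoc_algebra_eq_invariant_functions invariant_functions_in_unital_subalgebras
        algebra_equiv_invariant_functions agree_iff_bundle_kernel_eq
        bundle_kernel_quotient_bundle equiv_bundle_kernel)
  have agree: "agree_up_to_relabeling S B1 B2 \<longleftrightarrow> assoc_algebra S B1 = assoc_algebra S B2"
    if "B1 \<in> bundles S" "B2 \<in> bundles S"
    for B1 :: "('a, 'b) scheme_bundle" and B2 :: "('a, 'c) scheme_bundle"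
  proof -
    \<comment> \<open>Applying \<open>algebra_equiv\<close> recovers each kernel from its algebra of
      invariant functions.\<close>
    have "bundle_kernel S B1 = bundle_kernel S B2"
      if "invariant_functions (outcomes S) (bundle_kernel S B1)
        = invariant_functions (outcomes S) (bundle_kernel S B2)"
      using arg_cong[OF that, of ?a]
      by (simp only: algebra_equiv_invariant_functions[OF equiv_bundle_kernel])
    then show ?thesis
      unfolding agree_iff_bundle_kernel_eq[OF that]
        that[THEN assoc_algebra_eq_invariant_functions] by auto
  qed
  show ?thesis
    by (intro conjI ballI equiv_relabeling assoc_algebra_respects_relabeling c(1) a(1) q(1) part
        c(2)[rule_format] a(2)[rule_format] q(2)[rule_format] b[THEN conjunct1] b[THEN conjunct2]
        agree)
qed

end
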